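(* Let $n \geq 2$ be an integer, let $d > 1$ be an odd integer, and let $\rho$ be a density matrix over $\mathcal{H} = (\mathbb{C}^d)^{\otimes n}$ (an $n$-qudit state of local dimension $d$). If $\rho$ admits a set of NC value assignments, then its discrete Wigner function satisfies $W_\rho(\mathbf{u}) \geq 0$ for all $\mathbf{u} \in V = \mathbb{Z}_d^n\times\mathbb{Z}_d^n$.
   Context: $\mathbb{Z}_d$ is the ring of integers modulo $d$ ($d$ odd, so $2$ is invertible in $\mathbb{Z}_d$), $\omega = e^{2i\pi/d}$, and $U_d = \{\omega^s \mid s \in \mathbb{Z}_d\}$. Let $(|a\rangle)_{a\in\mathbb{Z}_d}$ be an orthonormal basis of $\mathbb{C}^d$. For $\mathbf{a},\mathbf{b}\in\mathbb{Z}_d^n$, $(\mathbf{a}|\mathbf{b}) = \sum_{i=1}^n a_i b_i$. Vectors of $V = \mathbb{Z}_d^n \times \mathbb{Z}_d^n$ are written $\mathbf{u} = (\mathbf{u_Z},\mathbf{u_X})$, and $[\mathbf{u},\mathbf{v}] = (\mathbf{u_Z}|\mathbf{v_X}) - (\mathbf{u_X}|\mathbf{v_Z}) \in \mathbb{Z}_d$. Pauli matrices on $\mathbb{C}^d$: $X|a\rangle = |a+1\rangle$, $Z|a\rangle = \omega^a|a\rangle$. For $\mathbf{a}\in\mathbb{Z}_d^n$: $Z^{\mathbf{a}} = Z^{a_1}\otimes\cdots\otimes Z^{a_n}$, $X^{\mathbf{a}} = X^{a_1}\otimes\cdots\otimes X^{a_n}$. Heisenberg-Weyl operators: $T_{\mathbf{u}}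 = \omega^{-(\mathbf{u_Z}|\mathbf{u_X})/2} Z^{\mathbf{u_Z}}X^{\mathbf{u_X}}$ for $\mathbf{u}\in V$, where division by $2$ is in $\mathbb{Z}_d$. Gross' discrete Wigner function of $\rho$ is $W_\rho(\mathbf{u}) = d^{-n}\operatorname{Tr}(A_{\mathbf{u}}\rho)$, where $A_{\mathbf{u}} = d^{-n}\sum_{\mathbf{v}\in V}\omega^{[\mathbf{u},\mathbf{v}]}T_{\mathbf{v}}$; it is a real-valued function on $V$. A set of NC (non-contextual) value assignments for $\rho$ is a triple $(S,q_\rho,\lambda)$ where $S$ is a finite set, $q_\rho$ is a probability distribution over $S$, and $\lambda$ is a collection of maps $\lambda_\nu : V\to U_d$, one for each $\nu\in S$, such that: (1) for all $\nu \in S$ and $\mathbf{u},\mathbf{v}\in V$, $[\mathbf{u},\mathbf{v}]=0$ implies $\lambda_\nu(\mathbf{u}+\mathbf{v}) = \lambda_\nu(\mathbf{u})\lambda_\nu(\mathbf{v})$; (2) for all $\mathbf{u}\in V$, $\operatorname{Tr}(T_{\mathbf{u}}\rho) = \sum_{\nu\in S}\lambda_\nu(\mathbf{u})\,q_\rho(\nu)$. *)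

theory Defs
  imports "HOL-Analysis.Analysis" "Berlekamp_Zassenhaus.Finite_Field"
begin

text \<open>
  The ring of integers modulo \<open>d\<close> is \<open>'d mod_ring\<close> with \<open>d = CARD('d)\<close>, and the number of
  qudits is \<open>n = CARD('n)\<close>. The tensor basis \<open>|a\<^sub>1\<rangle> \<otimes> \<dots> \<otimes> |a\<^sub>n\<rangle>\<close> of the \<open>n\<close>-qudit space is indexed
  by \<open>a :: 'd mod_ring ^ 'n\<close>, and operators are identified with their matrices in this basis
  (\<open>M $ a $ b\<close> being the entry in row \<open>a\<close> and column \<open>b\<close>).
\<close>

type_synonym 'd qudit_op = "complex ^ 'd mod_ring ^ 'd mod_ring"
type_synonym ('d, 'n) op = "complex ^ ('d mod_ring ^ 'n) ^ ('d mod_ring ^ 'n)"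
type_synonym ('d, 'n) phase_space = "('d mod_ring ^ 'n) \<times> ('d mod_ring ^ 'n)"

definition omega :: "'d itself \<Rightarrow> complex" where
  "omega _ = exp (2 * \<i> * of_real pi / of_nat CARD('d))"

text \<open>\<open>\<omega>\<^sup>s\<close> for an exponent \<open>s\<close> modulo \<open>d\<close>, computed with the representative in \<open>{0..<d}\<close>.\<close>

definition omega_pow :: "'d::nontriv mod_ring \<Rightarrow> complex" where
  "omega_pow s = omega TYPE('d) ^ nat (to_int_mod_ring s)"

definition roots_U :: "'d::nontriv itself \<Rightarrow> complex set" where
  "roots_U _ = range (omega_pow :: 'd mod_ring \<Rightarrow> complex)"

text \<open>Type class \<open>field\<close> provides division only for prime \<open>d\<close>. For odd \<open>d\<close> the element below
  exists uniquely, see \<open>half_unique\<close>.\<close>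

definition half :: "'d::nontriv mod_ring \<Rightarrow> 'd mod_ring" where
  "half a = (THE b. 2 * b = a)"

definition dotp :: "'d::nontriv mod_ring ^ 'n \<Rightarrow> 'd mod_ring ^ 'n \<Rightarrow> 'd mod_ring" where
  "dotp a b = (\<Sum>i\<in>UNIV. a $ i * b $ i)"

text \<open>A phase space point is the pair \<open>u = (u\<^sub>Z, u\<^sub>X)\<close>.\<close>

definition symp :: "('d::nontriv, 'n::finite) phase_space \<Rightarrow> ('d, 'n) phase_space \<Rightarrow> 'd mod_ring" where
  "symp u v = dotp (fst u) (snd v) - dotp (snd u) (fst v)"

definition scale_mat :: "complex \<Rightarrow> complex ^ 'b::finite ^ 'a::finite \<Rightarrow> complex ^ 'b ^ 'a" where
  "scale_mat c M = (\<chi> i j. c * M $ i $ j)"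

text \<open>Multiplication \<open>*\<close> on type \<open>vec\<close>, and hence the generic power \<open>^\<close>, would be entrywise.\<close>

primrec mat_pow :: "complex ^ 'a ^ 'a::finite \<Rightarrow> nat \<Rightarrow> complex ^ 'a ^ 'a" where
  "mat_pow M 0 = mat 1"
| "mat_pow M (Suc k) = M ** mat_pow M k"

text \<open>Matrix of \<open>M\<^sub>1 \<otimes> \<dots> \<otimes> M\<^sub>n\<close> in the tensor basis.\<close>

definition tensor_mat :: "('n::finite \<Rightarrow> 'd qudit_op) \<Rightarrow> ('d::nontriv, 'n) op" where
  "tensor_mat M = (\<chi> a b. \<Prod>i\<in>UNIV. M i $ (a $ i) $ (b $ i))"

definition pauli_X :: "'d::nontriv qudit_op" where
  "pauli_X = (\<chi> a b. if a = b + 1 then 1 else 0)"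

definition pauli_Z :: "'d::nontriv qudit_op" where
  "pauli_Z = (\<chi> a b. if a = b then omega_pow b else 0)"

definition Z_vec :: "'d::nontriv mod_ring ^ 'n \<Rightarrow> ('d, 'n) op" where
  "Z_vec a = tensor_mat (\<lambda>i. mat_pow pauli_Z (nat (to_int_mod_ring (a $ i))))"

definition X_vec :: "'d::nontriv mod_ring ^ 'n \<Rightarrow> ('d, 'n) op" where
  "X_vec a = tensor_mat (\<lambda>i. mat_pow pauli_X (nat (to_int_mod_ring (a $ i))))"

definition heisenberg_weyl :: "('d::nontriv, 'n::finite) phase_space \<Rightarrow> ('d, 'n) op" where
  "heisenberg_weyl u =
     scale_mat (omega_pow (- half (dotp (fst u) (snd u)))) (Z_vec (fst u) ** X_vec (snd u))"

definition phase_point_op :: "('d::nontriv, 'n::finite) phase_space \<Rightarrow> ('d, 'n) op" where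
  "phase_point_op u =
     scale_mat (1 / of_nat (CARD('d) ^ CARD('n)))
       (\<Sum>v\<in>UNIV. scale_mat (omega_pow (symp u v)) (heisenberg_weyl v))"

definition wigner :: "('d::nontriv, 'n::finite) op \<Rightarrow> ('d, 'n) phase_space \<Rightarrow> complex" where
  "wigner \<rho> u = 1 / of_nat (CARD('d) ^ CARD('n)) * trace (phase_point_op u ** \<rho>)"

definition density_matrix :: "complex ^ 'a ^ 'a::finite \<Rightarrow> bool" where
  "density_matrix \<rho> \<longleftrightarrow>
     (\<forall>i j. \<rho> $ i $ j = cnj (\<rho> $ j $ i)) \<and>
     (\<forall>x. (\<Sum>i\<in>UNIV. cnj (x $ i) * (\<rho> *v x) $ i) \<in> \<real> \<and>
          0 \<le> Re (\<Sum>i\<in>UNIV. cnj (x $ i) * (\<rho> *v x) $ i)) \<and>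
     trace \<rho> = 1"

definition NC_value_assignments ::
  "('d::nontriv, 'n::finite) op \<Rightarrow> 's set \<Rightarrow> ('s \<Rightarrow> real) \<Rightarrow>
     ('s \<Rightarrow> ('d, 'n) phase_space \<Rightarrow> complex) \<Rightarrow> bool" where
  "NC_value_assignments \<rho> S q l \<longleftrightarrow>
     finite S \<and>
     (\<forall>\<nu>\<in>S. 0 \<le> q \<nu>) \<and> (\<Sum>\<nu>\<in>S. q \<nu>) = 1 \<and>
     (\<forall>\<nu>\<in>S. \<forall>u. l \<nu> u \<in> roots_U TYPE('d)) \<and>
     (\<forall>\<nu>\<in>S. \<forall>u v. symp u v = 0 \<longrightarrow> l \<nu> (u + v) = l \<nu> u * l \<nu> v) \<and>
     (\<forall>u. trace (heisenberg_weyl u ** \<rho>) = (\<Sum>\<nu>\<in>S. l \<nu> u * of_real (q \<nu>)))"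

lemma half_unique:
  fixes a :: "'d::nontriv mod_ring"
  assumes "odd CARD('d)"
  shows "\<exists>!b. 2 * b = a"
proof -
  define h :: "'d mod_ring" where "h = of_nat ((CARD('d) + 1) div 2)"
  have "2 * h = of_nat (2 * ((CARD('d) + 1) div 2))"
    unfolding h_def by (simp only: of_nat_mult of_nat_numeral)
  also have "2 * ((CARD('d) + 1) div 2) = CARD('d) + 1"
    using assms by simp
  finally have h: "2 * h = 1"
    by (simp only: of_nat_add of_nat_card_eq_0 of_nat_1 add_0)
  show ?thesis
  proof (rule ex1I)
    show "2 * (h * a) = a"
      using h by (simp flip: mult.assoc)
    show "b = h * a" if "2 * b = a" for b
      using h that by (metis mult.assoc mult.commute mult_1)
  qed
qed

lemma pauli_X_ket: "pauli_X *v axis a 1 = axis (a + 1) 1"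
  by (auto simp: vec_eq_iff pauli_X_def matrix_vector_mult_def axis_def if_distrib intro!: sum.neutral cong: if_cong)

lemma pauli_Z_ket: "pauli_Z *v axis a 1 = omega_pow a *s axis a 1"
  by (auto simp: vec_eq_iff pauli_Z_def matrix_vector_mult_def axis_def if_distrib intro!: sum.neutral cong: if_cong)

end

theory Submission
  imports Defs
begin

text \<open>
  The map \<open>\<lambda>\<^sub>\<nu>\<close> turns out to be a character of the whole group \<open>V\<close>. It is multiplicative on
  commuting pairs, so it factors over the qudits, and it is multiplicative on \<open>Z\<close>-type and on
  \<open>X\<close>-type vectors separately. Hence only the defect \<open>g\<^sub>i(a,b)\<close>, the quotient of
  \<open>\<lambda>(a e\<^sub>i, b e\<^sub>i)\<close> by \<open>\<lambda>(a e\<^sub>i, 0) \<lambda>(0, b e\<^sub>i)\<close>, has to be trivial. For a second qudit \<open>j\<close> the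
  vectors \<open>(a e\<^sub>i, b' e\<^sub>j)\<close> and \<open>(a' e\<^sub>j, b e\<^sub>i)\<close> commute when \<open>a b = a' b'\<close>, which gives
  \<open>g\<^sub>i(a,b) g\<^sub>j(a',b') = 1\<close>. Therefore \<open>g\<^sub>i(a,b) = g\<^sub>i(-a,-b)\<close>, which is also the inverse of
  \<open>g\<^sub>i(a,b)\<close>, so \<open>g\<^sub>i(a,b)\<close> squares to 1. Being a \<open>d\<close>-th root of unity with \<open>d\<close> odd, it is 1.
  The Wigner function is then a combination of sums of characters over \<open>V\<close> with coefficients
  \<open>q\<^sub>\<rho>(\<nu>) \<ge> 0\<close>, and each such sum is 0 or \<open>|V|\<close>.
\<close>

lemma omega_power_card: "omega TYPE('d::nontriv) ^ CARD('d) = 1"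
proof -
  have "omega TYPE('d) ^ CARD('d) = exp (of_nat CARD('d) * (2 * \<i> * of_real pi / of_nat CARD('d)))"
    unfolding omega_def by (rule exp_of_nat_mult [symmetric])
  also have "of_nat CARD('d) * (2 * \<i> * of_real pi / of_nat CARD('d)) = 2 * of_real pi * \<i>"
    using nontriv[where ?'a = 'd] by (simp add: field_simps)
  finally show ?thesis by simp
qed

lemma omega_power_mod: "omega TYPE('d::nontriv) ^ (k mod CARD('d)) = omega TYPE('d) ^ k"
proof -
  have "omega TYPE('d) ^ k = omega TYPE('d) ^ (CARD('d) * (k div CARD('d)) + k mod CARD('d))"
    by simp
  then show ?thesis
    unfolding power_add power_mult omega_power_card by simp
qed

text \<open>Adding representatives may overshoot \<open>d\<close>; the reduction is harmless because
  \<open>omega\<close> has \<open>d\<close>-th power 1.\<close>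

lemma omega_pow_add: "omega_pow (a + b) = omega_pow a * omega_pow b"
  for a b :: "'d::nontriv mod_ring"
proof -
  have "0 \<le> to_int_mod_ring a" "0 \<le> to_int_mod_ring b"
    using range_to_int_mod_ring[where ?'a = 'd] by (metis atLeastLessThan_iff rangeI)+
  moreover have "to_int_mod_ring (a + b) = (to_int_mod_ring a + to_int_mod_ring b) mod int CARD('d)"
    by (transfer) simp
  ultimately have "nat (to_int_mod_ring (a + b))
      = (nat (to_int_mod_ring a) + nat (to_int_mod_ring b)) mod CARD('d)"
    by (simp add: nat_mod_distrib nat_add_distrib)
  then show ?thesis
    by (simp add: omega_pow_def omega_power_mod power_add)
qed

lemma omega_pow_power_card: "omega_pow s ^ CARD('d) = 1" for s :: "'d::nontriv mod_ring"
  unfolding omega_pow_def power_mult [symmetric]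
  by (subst mult.commute) (simp add: power_mult omega_power_card)

lemma roots_U_power_card: "x \<in> roots_U TYPE('d::nontriv) \<Longrightarrow> x ^ CARD('d) = 1"
  by (auto simp: roots_U_def omega_pow_power_card)

lemma dotp_axis_left [simp]: "dotp (axis i a) v = a * v $ i"
  by (simp add: dotp_def axis_def if_distrib [where f = "\<lambda>x. x * _"] cong: if_cong)

lemma dotp_axis_right [simp]: "dotp v (axis i a) = v $ i * a"
  by (simp add: dotp_def axis_def if_distrib cong: if_cong)

lemma dotp_zero [simp]: "dotp 0 v = 0" "dotp v 0 = 0"
  by (simp_all add: dotp_def)

lemma dotp_add_right: "dotp a (b + c) = dotp a b + dotp a c"
  by (simp add: dotp_def algebra_simps sum.distrib)

lemma dotp_minus_right: "dotp a (- b) = - dotp a b"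
  by (simp add: dotp_def sum_negf)

lemma dotp_commute: "dotp a b = dotp b a"
  by (simp add: dotp_def mult.commute)

lemma symp_zero_right [simp]: "symp u 0 = 0"
  by (simp add: symp_def)

lemma symp_add_right: "symp u (v + w) = symp u v + symp u w"
  by (simp add: symp_def dotp_add_right)

lemma symp_minus_self: "symp u (- u) = 0"
  by (simp add: symp_def dotp_minus_right dotp_commute)

lemma symp_sum_right: "symp u (\<Sum>i\<in>I. w i) = (\<Sum>i\<in>I. symp u (w i))"
  by (induction I rule: infinite_finite_induct) (simp_all add: symp_add_right)

text \<open>With \<open>k = 2 * m + 1\<close>, the common factor \<open>(y ^ 2) ^ m\<close> cancels
  from the equal \<open>k\<close>-th powers. This excludes a sign ambiguity among
  \<open>d\<close>-th roots of unity.\<close>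

lemma power2_eq_odd_power_eq_imp_eq:
  fixes x y :: "'a::idom"
  assumes "x ^ 2 = y ^ 2" "x ^ k = y ^ k" "odd k" "y \<noteq> 0"
  shows "x = y"
proof -
  obtain m where "k = 2 * m + 1"
    using \<open>odd k\<close> by (rule oddE)
  then have "x * (y ^ 2) ^ m = y * (y ^ 2) ^ m"
    using assms(1,2) by (simp add: power_mult)
  then show ?thesis
    using \<open>y \<noteq> 0\<close> by simp
qed

locale value_assignment =
  fixes l :: "('d::nontriv, 'n::finite) phase_space \<Rightarrow> complex"
  assumes root: "l u ^ CARD('d) = 1"
    and mult: "symp u v = 0 \<Longrightarrow> l (u + v) = l u * l v"
begin

lemma nonzero [simp]: "l u \<noteq> 0"
  using root [of u] by (auto simp: zero_power)

lemma zero [simp]: "l 0 = 1"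
  using mult [of 0 0] by simp

lemma uminus: "l (- u) = inverse (l u)"
  using mult [OF symp_minus_self, of u] by (simp add: inverse_eq_divide nonzero_eq_divide_eq mult.commute)

lemma sum_eq_prod:
  assumes "\<And>i j. i \<in> I \<Longrightarrow> j \<in> I \<Longrightarrow> i \<noteq> j \<Longrightarrow> symp (w i) (w j) = 0"
  shows "l (\<Sum>i\<in>I. w i) = (\<Prod>i\<in>I. l (w i))"
  using assms
proof (induction I rule: infinite_finite_induct)
  case (insert i I)
  have "symp (w i) (\<Sum>j\<in>I. w j) = 0"
    unfolding symp_sum_right using insert by (intro sum.neutral) auto
  then show ?case
    using insert by (simp add: mult)
qed simp_all

text \<open>Vectors supported on different qudits are symplectically orthogonal, so
  \<open>sum_eq_prod\<close> applies.\<close>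

lemma eq_prod_axis: "l (z, x) = (\<Prod>i\<in>UNIV. l (axis i (z $ i), axis i (x $ i)))"
proof -
  have "(z, x) = (\<Sum>i\<in>UNIV. (axis i (z $ i), axis i (x $ i)))"
    by (simp add: prod_eq_iff fst_sum snd_sum vec_eq_iff axis_def)
  moreover have "l (\<Sum>i\<in>UNIV. (axis i (z $ i), axis i (x $ i))) =
      (\<Prod>i\<in>UNIV. l (axis i (z $ i), axis i (x $ i)))"
    by (rule sum_eq_prod) (simp add: symp_def, simp add: axis_def)
  ultimately show ?thesis by simp
qed

text \<open>The same sum is split in two ways: by qudit, where the supports are disjoint, and
  crosswise, where the symplectic form is \<open>a * b - a' * b' = 0\<close>.\<close>

lemma two_qudit_relation:
  assumes "i \<noteq> j" "a * b = a' * b'"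
  shows "l (axis i a, axis i b) * l (axis j a', axis j b') =
    (l (axis i a, 0) * l (0, axis i b)) * (l (axis j a', 0) * l (0, axis j b'))"
proof -
  have "l (axis i a, axis i b) * l (axis j a', axis j b')
      = l ((axis i a, axis i b) + (axis j a', axis j b'))"
    using assms(1) by (intro mult [symmetric]) (simp add: symp_def, simp add: axis_def)
  also have "(axis i a, axis i b) + (axis j a', axis j b')
      = (axis i a, axis j b') + (axis j a', axis i b)"
    by simp
  also have "l \<dots> = l (axis i a, axis j b') * l (axis j a', axis i b)"
    using assms(2) by (intro mult) (simp add: symp_def mult.commute)
  also have "l (axis i a, axis j b') = l (axis i a, 0) * l (0, axis j b')"
    using mult [of "(axis i a, 0)" "(0, axis j b')"] assms(1)
    by (simp add: symp_def) (simp add: axis_def)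
  also have "l (axis j a', axis i b) = l (axis j a', 0) * l (0, axis i b)"
    using mult [of "(axis j a', 0)" "(0, axis i b)"] assms(1)
    by (simp add: symp_def) (simp add: axis_def)
  finally show ?thesis by (simp add: ac_simps)
qed

lemma axis_split:
  assumes "CARD('n) \<ge> 2" "odd CARD('d)"
  shows "l (axis i a, axis i b) = l (axis i a, 0) * l (0, axis i b)"
proof -
  obtain j :: 'n where j: "i \<noteq> j"
    using assms(1) by (metis UNIV_I card_2_iff' ex_card insertE is_singletonI' is_singleton_altdef
        not_numeral_le_zero numeral_le_one_iff one_neq_zero semiring_norm(69) subset_UNIV)
  let ?P = "l (axis i a, axis i b)" and ?R = "l (axis i a, 0) * l (0, axis i b)"
  let ?Q = "l (axis j a, axis j b)" and ?R' = "l (axis j a, 0) * l (0, axis j b)"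
  have axis_minus: "axis i (- c) = - axis i c" for c :: "'d mod_ring"
    by (simp add: vec_eq_iff axis_def)
  have neg: "l (axis i (- a), axis i (- b)) = inverse ?P" "l (axis i (- a), 0) = inverse (l (axis i a, 0))"
    "l (0, axis i (- b)) = inverse (l (0, axis i b))"
    using uminus [of "(axis i a, axis i b)"] uminus [of "(axis i a, 0)"] uminus [of "(0, axis i b)"]
    by (simp_all add: axis_minus)
  have 1: "?P * ?Q = ?R * ?R'"
    using j by (rule two_qudit_relation) simp
  \<comment> \<open>The relation applies again since \<open>(- a) * (- b) = a * b\<close>.\<close>
  have "inverse ?P * ?Q = inverse ?R * ?R'"
    using two_qudit_relation [OF j, of "- a" "- b" a b] by (simp add: neg)
  then have 2: "?R * ?Q = ?P * ?R'"
    by (simp add: field_simps)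
  \<comment> \<open>Combining \<open>1\<close> and \<open>2\<close> shows that the defect
    \<open>?P / ?R\<close> squares to 1; the auxiliary factor \<open>?Q * ?R'\<close> is nonzero and
    cancels.\<close>
  have "?P ^ 2 * (?Q * ?R') = (?P * ?Q) * (?P * ?R')"
    by (simp only: power2_eq_square ac_simps)
  also have "\<dots> = (?R * ?R') * (?R * ?Q)"
    by (simp only: 1 2)
  also have "\<dots> = ?R ^ 2 * (?Q * ?R')"
    by (simp only: power2_eq_square ac_simps)
  finally have "?P ^ 2 = ?R ^ 2"
    by simp
  then show ?thesis
    by (rule power2_eq_odd_power_eq_imp_eq [where k = "CARD('d)"])
       (simp_all add: assms(2) root power_mult_distrib)
qed

lemma character:
  assumes "CARD('n) \<ge> 2" "odd CARD('d)"
  shows "l (u + v) = l u * l v"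
proof -
  have axis_zero: "axis i 0 = (0 :: 'd mod_ring ^ 'n)" for i
    by (simp add: vec_eq_iff axis_def)
  have zero': "l (0, 0) = 1"
    using zero by (simp add: zero_prod_def)
  have split: "l (z, x) = l (z, 0) * l (0, x)" for z x
    unfolding eq_prod_axis [of z x] eq_prod_axis [of z 0] eq_prod_axis [of 0 x]
      axis_split [OF assms] by (simp add: prod.distrib axis_zero zero')
  obtain z x z' x' where [simp]: "u = (z, x)" "v = (z', x')"
    by (metis surj_pair)
  have "l (z + z', 0) = l (z, 0) * l (z', 0)" "l (0, x + x') = l (0, x) * l (0, x')"
    using mult [of "(z, 0)" "(z', 0)"] mult [of "(0, x)" "(0, x')"] by (simp_all add: symp_def)
  then show ?thesis
    using split [of "z + z'" "x + x'"] split [of z x] split [of z' x'] by simp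
qed

end

text \<open>Translation by \<open>w\<close> permutes the group and multiplies the sum by
  \<open>c w\<close>, so the sum vanishes once some \<open>c w\<close> differs from 1.\<close>

lemma sum_character_cases:
  fixes c :: "'a::{finite, ab_group_add} \<Rightarrow> 'b::idom"
  assumes "\<And>u v. c (u + v) = c u * c v"
  shows "(\<Sum>v\<in>UNIV. c v) = 0 \<or> (\<Sum>v\<in>UNIV. c v) = of_nat CARD('a)"
proof (cases "\<forall>w. c w = 1")
  case False
  then obtain w where w: "c w \<noteq> 1" by blast
  have "bij ((+) w)"
    by (rule bijI') (auto, metis add_diff_cancel_left' add.commute diff_add_cancel)
  then have "(\<Sum>v\<in>UNIV. c v) = (\<Sum>v\<in>UNIV. c (w + v))"
    by (simp add: sum.reindex_bij_betw [symmetric])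
  also have "\<dots> = c w * (\<Sum>v\<in>UNIV. c v)"
    by (simp add: assms sum_distrib_left)
  finally show ?thesis
    using w by (simp add: algebra_simps)
qed simp

lemma sum_nonneg_Reals: "(\<And>x. x \<in> A \<Longrightarrow> f x \<in> \<real>\<^sub>\<ge>\<^sub>0) \<Longrightarrow> (\<Sum>x\<in>A. f x) \<in> \<real>\<^sub>\<ge>\<^sub>0"
  by (induction A rule: infinite_finite_induct) auto

lemma trace_scale_mat_mult: "trace (scale_mat c A ** B) = c * trace (A ** B)"
  by (simp add: trace_def scale_mat_def matrix_matrix_mult_def sum_distrib_left mult.assoc)

lemma trace_sum_mult: "trace ((\<Sum>v\<in>I. A v) ** B) = (\<Sum>v\<in>I. trace (A v ** B))"
  for B :: "complex ^ 'a ^ 'a::finite"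
proof (induction I rule: infinite_finite_induct)
  case (insert v I)
  then show ?case
    by (simp add: trace_def matrix_matrix_mult_def distrib_right sum.distrib)
qed (simp_all add: trace_def)

lemma wigner_eq_characteristic_sum:
  fixes \<rho> :: "('d::nontriv, 'n::finite) op"
  shows "wigner \<rho> u = 1 / of_nat (CARD('d) ^ CARD('n)) ^ 2 *
    (\<Sum>v\<in>UNIV. omega_pow (symp u v) * trace (heisenberg_weyl v ** \<rho>))"
  by (simp add: wigner_def phase_point_op_def trace_scale_mat_mult trace_sum_mult power2_eq_square)

theorem proposition1:
  fixes \<rho> :: "complex ^ ('d::nontriv mod_ring ^ 'n) ^ ('d mod_ring ^ 'n)"
    and u :: "('d mod_ring ^ 'n) \<times> ('d mod_ring ^ 'n)"
  assumes "CARD('n) \<ge> 2"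
    and "CARD('d) > 1"
    and "odd CARD('d)"
    and "density_matrix \<rho>"
    and "\<exists>(S :: 's set) q l. NC_value_assignments \<rho> S q l"
  shows "wigner \<rho> u \<in> \<real> \<and> 0 \<le> Re (wigner \<rho> u)"
proof -
  obtain S :: "'s set" and q l where NC: "NC_value_assignments \<rho> S q l"
    using assms(5) by blast
  \<comment> \<open>The phase is itself a character in \<open>v\<close>, so the twisted map
    \<open>c \<nu>\<close> remains one.\<close>
  define c where "c \<nu> v = omega_pow (symp u v) * l \<nu> v" for \<nu> v
  \<comment> \<open>Membership in \<open>\<real>\<^sub>\<ge>\<^sub>0\<close> carries realness and
    sign together.\<close>
  have c: "(\<Sum>v\<in>UNIV. c \<nu> v) \<in> \<real>\<^sub>\<ge>\<^sub>0" if "\<nu> \<in> S" for \<nu>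
  proof -
    interpret value_assignment "l \<nu>"
      using NC that by unfold_locales (auto simp: NC_value_assignments_def roots_U_power_card)
    have "c \<nu> (v + w) = c \<nu> v * c \<nu> w" for v w
      by (simp add: c_def character [OF assms(1,3)] symp_add_right omega_pow_add)
    then show ?thesis
      using sum_character_cases [of "c \<nu>"] by auto
  qed
  have "trace (heisenberg_weyl v ** \<rho>) = (\<Sum>\<nu>\<in>S. l \<nu> v * of_real (q \<nu>))" for v
    using NC unfolding NC_value_assignments_def by blast
  then have "wigner \<rho> u = 1 / of_nat (CARD('d) ^ CARD('n)) ^ 2 *
      (\<Sum>v\<in>UNIV. \<Sum>\<nu>\<in>S. of_real (q \<nu>) * c \<nu> v)"
    by (simp only: wigner_eq_characteristic_sum c_def sum_distrib_left ac_simps)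
  \<comment> \<open>Exchanging the sums isolates one full character sum for each
    \<open>\<nu>\<close>, weighted by its probability.\<close>
  also have "(\<Sum>v\<in>UNIV. \<Sum>\<nu>\<in>S. of_real (q \<nu>) * c \<nu> v) = (\<Sum>\<nu>\<in>S. of_real (q \<nu>) * (\<Sum>v\<in>UNIV. c \<nu> v))"
    unfolding sum_distrib_left by (rule sum.swap)
  also have "1 / of_nat (CARD('d) ^ CARD('n)) ^ 2 * \<dots> \<in> \<real>\<^sub>\<ge>\<^sub>0"
  proof (rule nonneg_Reals_mult_I)
    show "1 / of_nat (CARD('d) ^ CARD('n)) ^ 2 \<in> (\<real>\<^sub>\<ge>\<^sub>0 :: complex set)"
      by (intro nonneg_Reals_divide_I nonneg_Reals_pow_I) auto
    show "(\<Sum>\<nu>\<in>S. of_real (q \<nu>) * (\<Sum>v\<in>UNIV. c \<nu> v)) \<in> \<real>\<^sub>\<ge>\<^sub>0"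
      using NC by (auto simp: NC_value_assignments_def intro!: sum_nonneg_Reals [where A = S] nonneg_Reals_mult_I c)
  qed
  finally show ?thesis
    by (auto simp: nonneg_Reals_def)
qed

end
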